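(* There exist absolute constants $C, c > 0$ (independent of $\phi$ and of the family of rectangles below) such that the following holds. Let $\phi : (0,\infty)\times(0,\infty) \to (0,\infty)$ be any function that is non-decreasing in each variable separately, and let $\mathcal{B}_{\phi}(\mathbb{R}^3)$ be the collection of all rectangles in $\mathbb{R}^3$ with sides parallel to the coordinate axes whose side lengths in the first, second and third coordinate directions are $(x, y, \phi(x,y))$ for some $x, y > 0$. Then for any family $\{R_{\alpha}\} \subseteq \mathcal{B}_{\phi}(\mathbb{R}^3)$ there exists a subsequence (i.e. a finite or countable subfamily) $\{R_j\}$ of $\{R_\alpha\}$ such that (1) $$m\left(\bigcup_{\alpha} R_{\alpha}\right) \leq C\, m\left(\bigcup_{j} R_j\right),$$ and (2) $$\int_{\bigcup_j R_j} \exp\left(c \sum_j \chi_{R_j}\right) dm \leq C\, m\left(\bigcup_j R_j\right).$$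
   Context: Here $m$ denotes Lebesgue measure on $\mathbb{R}^3$, and $\chi_E$ denotes the characteristic (indicator) function of a set $E$. A "rectangle" in $\mathbb{R}^3$ means a three-dimensional parallelepiped (box) with sides parallel to the coordinate axes, i.e. a product $I_1\times I_2\times I_3$ of bounded intervals of positive length; it may be located anywhere in $\mathbb{R}^3$. Both sides of (1) and (2) are allowed to be $+\infty$. *)

theory Defs
  imports "HOL-Analysis.Analysis"
begin

text \<open>Bounded intervals may be open, closed or half-open. The empty set has length \<open>0\<close>
  and is therefore excluded whenever the length is required to be positive.\<close>

definition interval_of_length :: "real \<Rightarrow> real set \<Rightarrow> bool" where
  "interval_of_length l I \<longleftrightarrow> is_interval I \<and> bounded I \<and> measure lborel I = l"

definition box_of_sides :: "real \<Rightarrow> real \<Rightarrow> real \<Rightarrow> (real ^ 3) set \<Rightarrow> bool" where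
  "box_of_sides x y z R \<longleftrightarrow>
     (\<exists>I\<^sub>1 I\<^sub>2 I\<^sub>3. interval_of_length x I\<^sub>1 \<and> interval_of_length y I\<^sub>2 \<and> interval_of_length z I\<^sub>3 \<and>
        R = {v. v $ 1 \<in> I\<^sub>1 \<and> v $ 2 \<in> I\<^sub>2 \<and> v $ 3 \<in> I\<^sub>3})"

definition rectangles :: "(real \<Rightarrow> real \<Rightarrow> real) \<Rightarrow> (real ^ 3) set set" where
  "rectangles \<phi> = {R. \<exists>x>0. \<exists>y>0. box_of_sides x y (\<phi> x y) R}"

text \<open>A function \<open>(0,\<infinity>) \<times> (0,\<infinity>) \<rightarrow> (0,\<infinity>)\<close> is modelled by a total function,
  constrained only at positive arguments.\<close>

definition admissible :: "(real \<Rightarrow> real \<Rightarrow> real) \<Rightarrow> bool" where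
  "admissible \<phi> \<longleftrightarrow>
     (\<forall>x>0. \<forall>y>0. \<phi> x y > 0) \<and>
     (\<forall>y>0. mono_on {0<..} (\<lambda>x. \<phi> x y)) \<and>
     (\<forall>x>0. mono_on {0<..} (\<lambda>y. \<phi> x y))"

text \<open>The exponential on \<open>[0,\<infinity>]\<close>, with \<open>exp \<infinity> = \<infinity>\<close>: a point may lie in infinitely many
  members of a countable family.\<close>

definition exp_ennreal :: "ennreal \<Rightarrow> ennreal" where
  "exp_ennreal t = (if t = \<infinity> then \<infinity> else ennreal (exp (enn2real t)))"

end

theory Submission
  imports Defs
begin

text \<open>
  List a finite family of rectangles by decreasing third side, breaking ties by decreasing sum of
  the first two sides. As \<open>\<phi>\<close> is monotone, no rectangle is longer than an earlier one in both of
  the first two directions. So an earlier rectangle that meets a later one covers it, up to a bounded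
  dilation, in the third direction and in at least one of the first two.

  Bounded dilations would spoil an exponential estimate, since dilating a family of boxes in
  several directions costs powers of the integrability exponent. They are avoided by enclosing every
  side in an interval of one of two nested grids, whose length exceeds that of the side by a factor
  at most 12 and is a monotone function of it (\<open>interval_in_grid\<close>). The order property survives
  this, and between grid intervals ``covers up to dilation'' becomes ``contains''.

  The selection is greedy: keep a box if \<open>2 ^ N - 1\<close> has average at most 3 over it, where \<open>N\<close> counts
  the boxes kept before it. Adding the increments gives \<open>\<integral> (2 ^ N - 1) \<le> 4 \<Sum> |R|\<close> for the kept boxes,
  which is the exponential estimate. If a box is rejected, then inside it \<open>N\<close> is a function of the first
  coordinate plus a function of the second, because every kept box that meets it contains it in one of
  these directions. Thus \<open>2 ^ N\<close> is a product, and as its average exceeds 4, one factor has an average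
  above 2; on every line in the direction of that factor, \<open>2 ^ N - 1\<close> has average at least 1 over
  the box (\<open>heavy_box_directions\<close>). The one-dimensional weak type inequality for nested intervals,
  summed over parallel lines (\<open>sliced_weak_type\<close>), bounds the union of the rejected boxes
  by \<open>\<integral> (2 ^ N - 1)\<close>, hence by \<open>\<Sum> |R|\<close>. All of this takes place among unions of cells of one finest
  grid, so it is stated for finite sets and cardinalities (\<open>greedy_selection\<close>).

  To return from grid boxes to the rectangles inside them, the overlap is bounded by
  \<open>N \<le> L + (2 ^ N - 1) / (2 * L)\<close>. Integrated over the union of the kept rectangles, with \<open>L\<close> large enough for
  the second term to be absorbed, this bounds the sum of their volumes by the volume of their union
  (\<open>single_grid_selection\<close>). The eight combinations of grids cost a factor 8. Since there are only
  countably many grid boxes, a family of rectangles may be replaced by countably many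
  representatives; a finite subfamily captures half of the covered volume if that is finite, and
  all representatives together have infinite volume if it is not.
\<close>

section \<open>Greedy selection among finite boxes\<close>

definition laminar :: "'a set set \<Rightarrow> bool" where
  "laminar \<B> \<longleftrightarrow> (\<forall>A\<in>\<B>. \<forall>B\<in>\<B>. A \<inter> B = {} \<or> A \<subseteq> B \<or> B \<subseteq> A)"

lemma laminar_subset: "laminar \<B> \<Longrightarrow> \<A> \<subseteq> \<B> \<Longrightarrow> laminar \<A>"
  unfolding laminar_def by blast

text \<open>The weak type \<open>(1,1)\<close> bound of a one-dimensional dyadic maximal function: the maximal members
  of a laminar family have the same union and are disjoint, so the averages add up with constant 1.\<close>

lemma laminar_weak_type:
  fixes f :: "'a \<Rightarrow> real"
  assumes "finite \<B>" and fin: "\<And>B. B \<in> \<B> \<Longrightarrow> finite B" and "laminar \<B>"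
    and avg: "\<And>B. B \<in> \<B> \<Longrightarrow> real (card B) \<le> sum f B"
  shows "real (card (\<Union>\<B>)) \<le> sum f (\<Union>\<B>)"
proof -
  define \<M> where "\<M> = {B\<in>\<B>. \<forall>B'\<in>\<B>. B \<subseteq> B' \<longrightarrow> B = B'}"
  have sub: "\<M> \<subseteq> \<B>"
    by (auto simp: \<M>_def)
  have Un: "\<Union>\<M> = \<Union>\<B>"
  proof
    show "\<Union>\<B> \<subseteq> \<Union>\<M>"
    proof
      fix y assume "y \<in> \<Union>\<B>"
      then obtain B where "B \<in> \<B>" "y \<in> B" by blast
      with finite_has_maximal2[OF \<open>finite \<B>\<close>, of B]
      obtain M where "M \<in> \<B>" "B \<subseteq> M" "\<forall>B'\<in>\<B>. M \<subseteq> B' \<longrightarrow> M = B'" by auto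
      then have "M \<in> \<M>" "y \<in> M" using \<open>y \<in> B\<close> by (auto simp: \<M>_def)
      then show "y \<in> \<Union>\<M>" by blast
    qed
  qed (use sub in blast)
  have disj: "\<forall>A\<in>\<M>. \<forall>B\<in>\<M>. A \<noteq> B \<longrightarrow> A \<inter> B = {}"
  proof (intro ballI impI)
    fix A B assume AB: "A \<in> \<M>" "B \<in> \<M>" "A \<noteq> B"
    then have "\<not> A \<subseteq> B" "\<not> B \<subseteq> A"
      by (auto simp: \<M>_def)
    then show "A \<inter> B = {}"
      using AB sub \<open>laminar \<B>\<close> by (meson laminar_def subsetD)
  qed
  have "card (\<Union>\<M>) = (\<Sum>B\<in>\<M>. card B)"
    using disj sub fin by (intro card_Union_disjoint) (auto simp: pairwise_def disjnt_def)
  then have "real (card (\<Union>\<M>)) = (\<Sum>B\<in>\<M>. real (card B))"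
    by simp
  also have "\<dots> \<le> (\<Sum>B\<in>\<M>. sum f B)"
    using sub avg by (intro sum_mono) auto
  also have "\<dots> = sum f (\<Union>\<M>)"
    using sum.Union_disjoint[of \<M> f] disj sub fin by (auto simp: subset_iff)
  finally show ?thesis
    by (simp add: Un)
qed

text \<open>The maximal inequality in one direction of a product: each fibre of a union of product
  sets is a union of members of the laminar family \<open>B ` J\<close>.\<close>

lemma sliced_weak_type:
  fixes P :: "'i \<Rightarrow> 'p set" and B :: "'i \<Rightarrow> 'b set" and f :: "'p \<times> 'b \<Rightarrow> real"
  assumes "finite J" and finP: "\<And>j. j \<in> J \<Longrightarrow> finite (P j)" and finB: "\<And>j. j \<in> J \<Longrightarrow> finite (B j)"
    and lam: "laminar (B ` J)" and "finite X" and sub: "(\<Union>j\<in>J. P j \<times> B j) \<subseteq> X"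
    and nonneg: "\<And>u. u \<in> X \<Longrightarrow> 0 \<le> f u"
    and avg: "\<And>j p. j \<in> J \<Longrightarrow> p \<in> P j \<Longrightarrow> real (card (B j)) \<le> (\<Sum>y\<in>B j. f (p, y))"
  shows "real (card (\<Union>j\<in>J. P j \<times> B j)) \<le> sum f X"
proof -
  define Q where "Q = (\<Union>j\<in>J. P j)"
  define F where "F p = \<Union>(B ` {j\<in>J. p \<in> P j})" for p
  have U: "(\<Union>j\<in>J. P j \<times> B j) = Sigma Q F"
    unfolding Q_def F_def by auto
  have finQ: "finite Q" and finF: "\<And>p. finite (F p)"
    using assms by (auto simp: Q_def F_def)
  have "real (card (Sigma Q F)) = (\<Sum>p\<in>Q. real (card (F p)))"
    using finQ finF by simp
  also have "\<dots> \<le> (\<Sum>p\<in>Q. \<Sum>y\<in>F p. f (p, y))"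
    unfolding F_def using \<open>finite J\<close> finB avg
    by (intro sum_mono laminar_weak_type laminar_subset[OF lam]) auto
  also have "\<dots> = sum f (Sigma Q F)"
    using finQ finF by (simp add: sum.Sigma)
  also have "\<dots> \<le> sum f X"
    using \<open>finite X\<close> sub nonneg unfolding U by (intro sum_mono2) auto
  finally show ?thesis
    by (simp add: U)
qed

definition overlap :: "('i \<Rightarrow> 'p set) \<Rightarrow> 'i set \<Rightarrow> 'p \<Rightarrow> nat" where
  "overlap E S p = card {s\<in>S. p \<in> E s}"

lemma overlap_mono: "finite S \<Longrightarrow> S' \<subseteq> S \<Longrightarrow> overlap E S' p \<le> overlap E S p"
  unfolding overlap_def by (intro card_mono) auto

lemma overlap_insert:
  assumes "finite S" "j \<notin> S"
  shows "overlap E (insert j S) p = overlap E S p + of_bool (p \<in> E j)"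
proof -
  have "{s\<in>insert j S. p \<in> E s} = (if p \<in> E j then insert j {s\<in>S. p \<in> E s} else {s\<in>S. p \<in> E s})"
    by auto
  then show ?thesis
    using assms by (simp add: overlap_def)
qed

text \<open>The step where the two-parameter structure enters. Let \<open>S\<close> be a family of boxes such that each of them that
  meets box \<open>j\<close> contains it in the third direction and in one of the first two. Inside box \<open>j\<close> the
  overlap then splits as \<open>h x + g y\<close>, where \<open>h\<close> counts the boxes that may fail to contain it in the first direction
  and \<open>g\<close> counts the others. Two averages whose product exceeds 4 cannot both be at most 2.\<close>

lemma heavy_box_directions:
  fixes A :: "'i \<Rightarrow> 'a set" and B :: "'i \<Rightarrow> 'b set" and C :: "'i \<Rightarrow> 'c set"
  defines "E \<equiv> \<lambda>i. A i \<times> B i \<times> C i"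
  assumes "finite S" and fin: "finite (A j)" "finite (B j)" "finite (C j)"
    and earlier: "\<And>i. i \<in> S \<Longrightarrow> E i \<inter> E j \<noteq> {} \<Longrightarrow> C j \<subseteq> C i \<and> (A j \<subseteq> A i \<or> B j \<subseteq> B i)"
    and heavy: "(\<Sum>p\<in>E j. 2 ^ overlap E S p - 1) > 3 * real (card (E j))"
  shows "(\<forall>x\<in>A j. \<forall>z\<in>C j. real (card (B j)) \<le> (\<Sum>y\<in>B j. 2 ^ overlap E S (x, y, z) - 1)) \<or>
         (\<forall>y\<in>B j. \<forall>z\<in>C j. real (card (A j)) \<le> (\<Sum>x\<in>A j. 2 ^ overlap E S (x, y, z) - 1))"
proof -
  \<comment> \<open>a box of \<open>S1\<close> constrains only the second coordinate of a point of box \<open>j\<close>, a box of \<open>S2\<close> only the first\<close>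
  define M where "M = {i\<in>S. E i \<inter> E j \<noteq> {}}"
  define S1 where "S1 = {i\<in>M. A j \<subseteq> A i}"
  define S2 where "S2 = {i\<in>M. \<not> A j \<subseteq> A i}"
  define g where "g y = overlap B S1 y" for y
  define h where "h x = overlap A S2 x" for x
  have split: "overlap E S (x, y, z) = h x + g y" if "x \<in> A j" "y \<in> B j" "z \<in> C j" for x y z
  proof -
    have "(x, y, z) \<in> E j"
      using that by (simp add: E_def)
    then have "{s\<in>S. (x, y, z) \<in> E s} = {s\<in>M. (x, y, z) \<in> E s}"
      by (auto simp: M_def)
    also have "\<dots> = {s\<in>S1. y \<in> B s} \<union> {s\<in>S2. x \<in> A s}"
      using earlier that unfolding S1_def S2_def M_def E_def by blast
    finally have "overlap E S (x, y, z) = card ({s\<in>S1. y \<in> B s} \<union> {s\<in>S2. x \<in> A s})"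
      by (simp add: overlap_def)
    also have "\<dots> = h x + g y"
      unfolding g_def h_def overlap_def Un_commute[of "{s\<in>S1. y \<in> B s}"]
      by (intro card_Un_disjoint finite_Collect_conjI) (auto simp: S1_def S2_def M_def \<open>finite S\<close>)
    finally show ?thesis .
  qed
  define G where "G = (\<Sum>y\<in>B j. (2::real) ^ g y)"
  define H where "H = (\<Sum>x\<in>A j. (2::real) ^ h x)"
  have nonneg: "G \<ge> 0" "H \<ge> 0"
    by (auto simp: G_def H_def sum_nonneg)
  have "(\<Sum>p\<in>E j. (2::real) ^ overlap E S p) = (\<Sum>x\<in>A j. \<Sum>y\<in>B j. \<Sum>z\<in>C j. 2 ^ overlap E S (x, y, z))"
    by (simp add: E_def sum.cartesian_product)
  also have "\<dots> = (\<Sum>x\<in>A j. \<Sum>y\<in>B j. real (card (C j)) * (2 ^ h x * 2 ^ g y))"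
    by (simp add: split power_add)
  also have "\<dots> = card (C j) * (H * G)"
    unfolding G_def H_def sum_product by (simp add: sum_distrib_left)
  finally have "card (C j) * (4 * real (card (A j)) * card (B j)) < card (C j) * (H * G)"
    using heavy by (simp add: sum_subtractf E_def card_cartesian_product algebra_simps)
  then have prod: "(2 * real (card (A j))) * (2 * card (B j)) < H * G"
    using mult_less_cancel_left_disj[of "real (card (C j))"] by simp
  have "G > 2 * real (card (B j)) \<or> H > 2 * real (card (A j))"
  proof (rule ccontr)
    assume "\<not> ?thesis"
    then have "H * G \<le> (2 * real (card (A j))) * (2 * card (B j))"
      using nonneg by (intro mult_mono) auto
    with prod show False by simp
  qed
  then show ?thesis
  proof
    assume *: "G > 2 * real (card (B j))"
    have "G \<le> (\<Sum>y\<in>B j. 2 ^ overlap E S (x, y, z))"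
      if "x \<in> A j" "z \<in> C j" for x z
      using that unfolding G_def by (intro sum_mono) (simp add: split)
    with * show ?thesis
      by (intro disjI1 ballI) (fastforce simp: sum_subtractf)
  next
    assume *: "H > 2 * real (card (A j))"
    have "H \<le> (\<Sum>x\<in>A j. 2 ^ overlap E S (x, y, z))"
      if "y \<in> B j" "z \<in> C j" for y z
      using that unfolding H_def by (intro sum_mono) (simp add: split)
    with * show ?thesis
      by (intro disjI2 ballI) (fastforce simp: sum_subtractf)
  qed
qed

text \<open>Adding a box doubles \<open>2 ^ overlap\<close> on that box. The threshold 3 on the average of the second summand
  therefore limits the growth to four times the size of the box.\<close>

lemma sum_excess_insert:
  assumes "finite S" "j \<notin> S" "finite X" "E j \<subseteq> X"
  shows "(\<Sum>p\<in>X. 2 ^ overlap E (insert j S) p - 1 :: real) =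
    (\<Sum>p\<in>X. 2 ^ overlap E S p - 1) + (\<Sum>p\<in>E j. 2 ^ overlap E S p - 1) + real (card (E j))"
proof -
  have "(\<Sum>p\<in>X. 2 ^ overlap E (insert j S) p - 1 :: real) =
      (\<Sum>p\<in>X. (2 ^ overlap E S p - 1) + (if p \<in> E j then 2 ^ overlap E S p else 0))"
    using assms by (intro sum.cong) (auto simp: overlap_insert)
  also have "\<dots> = (\<Sum>p\<in>X. 2 ^ overlap E S p - 1) + (\<Sum>p\<in>E j. 2 ^ overlap E S p)"
    using assms by (simp add: sum.distrib sum.inter_restrict[symmetric] Int_absorb1)
  finally show ?thesis
    by (simp add: sum_subtractf)
qed

text \<open>The hypothesis \<open>last\<close> says that the boxes can be ordered so that each box is related in the
  required way to the earlier boxes that it meets: it yields a last box for every subfamily. The induction removes that last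
  box, selects among the others, and then decides about it. Rejected boxes stay heavy
  because the overlap only grows. In the bound by 9, the boxes heavy along either direction contribute at most
  4 each, and the selected boxes themselves contribute 1.\<close>

theorem greedy_selection:
  fixes A :: "'i \<Rightarrow> 'a set" and B :: "'i \<Rightarrow> 'b set" and C :: "'i \<Rightarrow> 'c set"
  defines "E \<equiv> \<lambda>i. A i \<times> B i \<times> C i"
  assumes "finite T"
    and fin: "\<And>i. i \<in> T \<Longrightarrow> finite (A i)" "\<And>i. i \<in> T \<Longrightarrow> finite (B i)" "\<And>i. i \<in> T \<Longrightarrow> finite (C i)"
    and lam: "laminar (A ` T)" "laminar (B ` T)"
    and last: "\<And>T'. T' \<subseteq> T \<Longrightarrow> T' \<noteq> {} \<Longrightarrow>
      \<exists>j\<in>T'. \<forall>i\<in>T'. E i \<inter> E j \<noteq> {} \<longrightarrow> C j \<subseteq> C i \<and> (A j \<subseteq> A i \<or> B j \<subseteq> B i)"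
  shows "\<exists>S\<subseteq>T. (\<Sum>p\<in>\<Union>(E ` T). 2 ^ overlap E S p - 1) \<le> 4 * (\<Sum>s\<in>S. real (card (E s))) \<and>
    real (card (\<Union>(E ` T))) \<le> 9 * (\<Sum>s\<in>S. real (card (E s)))"
proof -
  define X where "X = \<Union>(E ` T)"
  have finE: "finite (E i)" if "i \<in> T" for i
    using fin that by (simp add: E_def)
  have "finite X"
    using \<open>finite T\<close> finE by (auto simp: X_def)
  define along_B where "along_B S j \<longleftrightarrow>
    (\<forall>x\<in>A j. \<forall>z\<in>C j. real (card (B j)) \<le> (\<Sum>y\<in>B j. 2 ^ overlap E S (x, y, z) - 1))" for S j
  define along_A where "along_A S j \<longleftrightarrow>
    (\<forall>y\<in>B j. \<forall>z\<in>C j. real (card (A j)) \<le> (\<Sum>x\<in>A j. 2 ^ overlap E S (x, y, z) - 1))" for S j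
  have excess_mono: "(2::real) ^ overlap E S p - 1 \<le> 2 ^ overlap E (insert j S) p - 1"
    if "finite S" for S j p
    using that by (intro diff_right_mono power_increasing overlap_mono) auto
  have heavy_mono: "along_B (insert j S) i \<or> along_A (insert j S) i"
    if "along_B S i \<or> along_A S i" "finite S" for S i j
    using that(1) unfolding along_B_def along_A_def
    by (meson excess_mono[OF \<open>finite S\<close>] sum_mono order_trans)
  have "\<exists>S\<subseteq>T'. (\<Sum>p\<in>X. 2 ^ overlap E S p - 1) \<le> 4 * (\<Sum>s\<in>S. real (card (E s))) \<and>
      (\<forall>i\<in>T'-S. along_B S i \<or> along_A S i)" if "T' \<subseteq> T" for T'
    using finite_subset[OF that \<open>finite T\<close>] that
  proof (induction T' rule: finite_psubset_induct)
    case (psubset T')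
    show ?case
    proof (cases "T' = {}")
      case True
      then show ?thesis
        by (simp add: overlap_def)
    next
      case False
      obtain j where "j \<in> T'" and
        j: "\<forall>i\<in>T'. E i \<inter> E j \<noteq> {} \<longrightarrow> C j \<subseteq> C i \<and> (A j \<subseteq> A i \<or> B j \<subseteq> B i)"
        using last[OF psubset.prems False] by (rule bexE)
      have "T' - {j} \<subset> T'" "T' - {j} \<subseteq> T"
        using \<open>j \<in> T'\<close> psubset.prems by auto
      from psubset.IH[OF this] obtain S where S: "S \<subseteq> T' - {j}"
        "(\<Sum>p\<in>X. 2 ^ overlap E S p - 1) \<le> 4 * (\<Sum>s\<in>S. real (card (E s)))"
        "\<forall>i\<in>T'-{j}-S. along_B S i \<or> along_A S i"
        by auto
      have "j \<in> T" "finite S" "j \<notin> S"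
        using S(1) psubset.prems \<open>j \<in> T'\<close> \<open>finite T'\<close> by (auto intro: finite_subset)
      show ?thesis
      proof (cases "(\<Sum>p\<in>E j. 2 ^ overlap E S p - 1) > 3 * real (card (E j))")
        case True
        have "along_B S j \<or> along_A S j"
          unfolding along_B_def along_A_def E_def
          using True S(1) j fin \<open>j \<in> T\<close> \<open>finite S\<close>
          by (intro heavy_box_directions) (auto simp: E_def)
        then have "\<forall>i\<in>T'-S. along_B S i \<or> along_A S i"
          using S(3) by auto
        with S(1,2) show ?thesis
          by (intro exI[of _ S] conjI) auto
      next
        case False
        have "E j \<subseteq> X"
          using \<open>j \<in> T\<close> by (auto simp: X_def)
        with False S(2) have "(\<Sum>p\<in>X. 2 ^ overlap E (insert j S) p - 1)
            \<le> 4 * (\<Sum>s\<in>insert j S. real (card (E s)))"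
          using \<open>finite S\<close> \<open>j \<notin> S\<close> \<open>finite X\<close> by (simp add: sum_excess_insert)
        moreover have "\<forall>i\<in>T'-insert j S. along_B (insert j S) i \<or> along_A (insert j S) i"
          using S(3) heavy_mono[OF _ \<open>finite S\<close>] by auto
        ultimately show ?thesis
          using S(1) \<open>j \<in> T'\<close> by (intro exI[of _ "insert j S"] conjI) auto
      qed
    qed
  qed
  then obtain S where S: "S \<subseteq> T"
    "(\<Sum>p\<in>X. 2 ^ overlap E S p - 1) \<le> 4 * (\<Sum>s\<in>S. real (card (E s)))"
    "\<forall>i\<in>T-S. along_B S i \<or> along_A S i"
    by (meson order_refl)
  define J where "J = {i\<in>T. along_B S i}"
  define K where "K = {i\<in>T. along_A S i}"
  \<comment> \<open>reordering the coordinates puts the direction of the slices last\<close>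
  define swap_B where "swap_B = (\<lambda>(x::'a, y::'b, z::'c). ((x, z), y))"
  define swap_A where "swap_A = (\<lambda>(x::'a, y::'b, z::'c). ((y, z), x))"
  have inj: "inj_on swap_B U" "inj_on swap_A U" for U
    by (auto simp: swap_B_def swap_A_def inj_on_def)
  have img: "swap_B ` (\<Union>i\<in>I. E i) = (\<Union>i\<in>I. (A i \<times> C i) \<times> B i)"
    "swap_A ` (\<Union>i\<in>I. E i) = (\<Union>i\<in>I. (B i \<times> C i) \<times> A i)" for I
    by (force simp: swap_B_def swap_A_def E_def)+
  have "real (card (\<Union>i\<in>J. E i)) \<le> (\<Sum>p\<in>X. 2 ^ overlap E S p - 1)"
  proof -
    let ?f = "\<lambda>((x, z), y). 2 ^ overlap E S (x, y, z) - 1 :: real"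
    have "real (card (\<Union>i\<in>J. (A i \<times> C i) \<times> B i)) \<le> sum ?f (swap_B ` X)"
    proof (rule sliced_weak_type)
      show "(\<Union>i\<in>J. (A i \<times> C i) \<times> B i) \<subseteq> swap_B ` X"
        unfolding img(1)[symmetric] by (intro image_mono) (auto simp: J_def X_def)
      show "real (card (B i)) \<le> (\<Sum>y\<in>B i. ?f (p, y))" if "i \<in> J" "p \<in> A i \<times> C i" for i p
        using that by (auto simp: J_def along_B_def)
      show "laminar (B ` J)"
        by (rule laminar_subset[OF lam(2)]) (auto simp: J_def)
    qed (use \<open>finite X\<close> \<open>finite T\<close> fin in \<open>auto simp: J_def swap_B_def\<close>)
    also have "sum ?f (swap_B ` X) = (\<Sum>p\<in>X. 2 ^ overlap E S p - 1)"
      by (subst sum.reindex[OF inj(1)]) (auto simp: swap_B_def intro!: sum.cong)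
    finally show ?thesis
      by (simp add: img(1)[symmetric] card_image[OF inj(1)])
  qed
  moreover have "real (card (\<Union>i\<in>K. E i)) \<le> (\<Sum>p\<in>X. 2 ^ overlap E S p - 1)"
  proof -
    let ?f = "\<lambda>((y, z), x). 2 ^ overlap E S (x, y, z) - 1 :: real"
    have "real (card (\<Union>i\<in>K. (B i \<times> C i) \<times> A i)) \<le> sum ?f (swap_A ` X)"
    proof (rule sliced_weak_type)
      show "(\<Union>i\<in>K. (B i \<times> C i) \<times> A i) \<subseteq> swap_A ` X"
        unfolding img(2)[symmetric] by (intro image_mono) (auto simp: K_def X_def)
      show "real (card (A i)) \<le> (\<Sum>y\<in>A i. ?f (p, y))" if "i \<in> K" "p \<in> B i \<times> C i" for i p
        using that by (auto simp: K_def along_A_def)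
      show "laminar (A ` K)"
        by (rule laminar_subset[OF lam(1)]) (auto simp: K_def)
    qed (use \<open>finite X\<close> \<open>finite T\<close> fin in \<open>auto simp: K_def swap_A_def\<close>)
    also have "sum ?f (swap_A ` X) = (\<Sum>p\<in>X. 2 ^ overlap E S p - 1)"
      by (subst sum.reindex[OF inj(2)]) (auto simp: swap_A_def intro!: sum.cong)
    finally show ?thesis
      by (simp add: img(2)[symmetric] card_image[OF inj(2)])
  qed
  moreover have "card (\<Union>i\<in>S. E i) \<le> (\<Sum>s\<in>S. card (E s))"
    using S(1) \<open>finite T\<close> by (intro card_UN_le) (auto intro: finite_subset)
  then have "real (card (\<Union>i\<in>S. E i)) \<le> (\<Sum>s\<in>S. real (card (E s)))"
    by (metis of_nat_le_iff of_nat_sum)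
  moreover have "card X \<le> card (\<Union>i\<in>J. E i) + card (\<Union>i\<in>K. E i) + card (\<Union>i\<in>S. E i)"
  proof -
    have "X \<subseteq> (\<Union>i\<in>J. E i) \<union> (\<Union>i\<in>K. E i) \<union> (\<Union>i\<in>S. E i)"
      using S(3) by (auto simp: X_def J_def K_def)
    then have "card X \<le> card ((\<Union>i\<in>J. E i) \<union> (\<Union>i\<in>K. E i) \<union> (\<Union>i\<in>S. E i))"
      using \<open>finite T\<close> finite_subset[OF S(1)] S(1) finE by (intro card_mono) (auto simp: J_def K_def)
    then show ?thesis
      by (meson card_Un_le order_trans add_right_mono)
  qed
  ultimately have "real (card X) \<le> 9 * (\<Sum>s\<in>S. real (card (E s)))"
    using S(2) by linarith
  with S(1,2) show ?thesis
    unfolding X_def by (intro exI[of _ S] conjI)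
qed

section \<open>Two nested grids of intervals\<close>

text \<open>At level \<open>k\<close> the grid consists of the half-open intervals of length \<open>4 ^ k\<close> with left endpoints
  \<open>4 ^ k * (m + s / 3)\<close>. Ratio 4 makes each of the two grids nested: the shift at level \<open>k + 1\<close>
  exceeds the one at level \<open>k\<close> by \<open>s * 4 ^ k\<close>, a multiple of the length at level \<open>k\<close>.\<close>

definition grid_index :: "bool \<Rightarrow> int \<Rightarrow> real \<Rightarrow> int" where
  "grid_index s k x = \<lfloor>x / 4 powi k - of_bool s / 3\<rfloor>"

definition grid_interval :: "bool \<Rightarrow> int \<Rightarrow> int \<Rightarrow> real set" where
  "grid_interval s k m = {x. grid_index s k x = m}"

lemma grid_index_step: "grid_index s (k + 1) x = (grid_index s k x - of_bool s) div 4"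
proof -
  have "x / 4 powi (k + 1) - of_bool s / 3 = (x / 4 powi k - of_bool s / 3 - of_int (of_bool s)) / of_int 4"
    by (cases s) (simp_all add: power_int_add field_simps)
  then show ?thesis
    unfolding grid_index_def by (simp only: floor_divide_real_eq_div floor_diff_of_int)
qed

lemma grid_index_coarsen:
  assumes "k \<le> l" "grid_index s k x = grid_index s k y"
  shows "grid_index s l x = grid_index s l y"
  using assms(1) by (induction rule: int_ge_induct) (simp_all add: assms(2) grid_index_step)

lemma grid_interval_eq:
  "grid_interval s k m = {4 powi k * (m + of_bool s / 3)..<4 powi k * (m + of_bool s / 3) + 4 powi k}"
  unfolding grid_interval_def grid_index_def floor_eq_iff by (auto simp: field_simps)

lemma interval_of_length_grid_interval: "interval_of_length (4 powi k) (grid_interval s k m)"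
  unfolding interval_of_length_def grid_interval_eq
  by (simp add: is_interval_co)

lemma grid_interval_subset:
  assumes "k \<le> l" "grid_interval s k m \<inter> grid_interval s l n \<noteq> {}"
  shows "grid_interval s k m \<subseteq> grid_interval s l n"
  using assms(2) unfolding grid_interval_def by (auto intro: grid_index_coarsen[OF assms(1)])

text \<open>The least level whose intervals are longer than \<open>3 * l\<close>, for \<open>l > 0\<close>, so that a side
  of length \<open>l\<close> fits into an interval of one of the two grids. The level depends on the length alone and
  monotonically, so comparisons between the sides of two rectangles carry over to their grid boxes.\<close>

definition grid_level :: "real \<Rightarrow> int" where
  "grid_level l = \<lfloor>log 4 (3 * l)\<rfloor> + 1"

lemma grid_level_mono: "0 < l \<Longrightarrow> l \<le> l' \<Longrightarrow> grid_level l \<le> grid_level l'"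
  unfolding grid_level_def by (intro add_right_mono floor_mono) simp

lemma grid_level_bounds:
  assumes "0 < l"
  shows "3 * l < 4 powi grid_level l" "4 powi grid_level l \<le> 12 * l"
proof -
  have "log 4 (3 * l) < real_of_int (grid_level l)" "real_of_int (grid_level l) - 1 \<le> log 4 (3 * l)"
    unfolding grid_level_def by linarith+
  with assms have "3 * l < 4 powr grid_level l" "4 powr (real_of_int (grid_level l) - 1) \<le> 3 * l"
    by (simp_all add: log_less_iff le_log_iff)
  then show "3 * l < 4 powi grid_level l" "4 powi grid_level l \<le> 12 * l"
    by (simp_all add: powr_diff powr_real_of_int')
qed

lemma interval_of_length_between:
  assumes "interval_of_length l I" "l > 0"
  obtains a where "{a<..<a + l} \<subseteq> I" "I \<subseteq> {a..a + l}"
proof -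
  have I: "is_interval I" "bounded I" "measure lborel I = l"
    using assms by (auto simp: interval_of_length_def)
  have "I \<noteq> {}"
    using assms I by auto
  define a where "a = Inf I"
  define b where "b = Sup I"
  have bdd: "bdd_below I" "bdd_above I"
    using I(2) by (auto intro: bounded_imp_bdd_below bounded_imp_bdd_above)
  have "I \<subseteq> {a..b}"
    using bdd by (auto simp: a_def b_def intro: cInf_lower cSup_upper)
  moreover have "{a<..<b} \<subseteq> I"
  proof
    fix x assume "x \<in> {a<..<b}"
    then obtain u v where "u \<in> I" "u < x" "v \<in> I" "x < v"
      using bdd \<open>I \<noteq> {}\<close> by (auto simp: a_def b_def cInf_less_iff less_cSup_iff)
    then show "x \<in> I"
      using I(1) by (meson is_interval_1 less_imp_le)
  qed
  moreover have "a \<le> b"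
    using \<open>I \<noteq> {}\<close> bdd by (simp add: a_def b_def cInf_le_cSup)
  moreover have "l = b - a"
  proof -
    have "I \<in> sets borel"
      by (rule real_interval_borel_measurable[OF I(1)])
    then have "I \<in> fmeasurable lborel"
      using I(2) by (intro fmeasurableI emeasure_bounded_finite) auto
    moreover have "{a..b} \<in> fmeasurable lborel"
      by (intro fmeasurableI emeasure_bounded_finite) auto
    ultimately have "measure lborel {a<..<b} \<le> measure lborel I" "measure lborel I \<le> measure lborel {a..b}"
      using \<open>{a<..<b} \<subseteq> I\<close> \<open>I \<subseteq> {a..b}\<close> \<open>I \<in> sets borel\<close>
      by (auto intro!: measure_mono_fmeasurable simp del: measure_lborel_Icc content_real_if)
    with \<open>a \<le> b\<close> I(3) show ?thesis by simp
  qed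
  ultimately show ?thesis
    by (intro that[of a]) auto
qed

text \<open>Endpoints of the two grids at one level are at least a third of the grid length apart, so an
  interval shorter than that is cut by at most one of the grids.\<close>

lemma interval_in_grid:
  assumes "interval_of_length l I" "l > 0"
  shows "\<exists>s m. I \<subseteq> grid_interval s (grid_level l) m"
proof -
  obtain a where a: "{a<..<a + l} \<subseteq> I" "I \<subseteq> {a..a + l}"
    by (rule interval_of_length_between[OF assms])
  define q :: real where "q = 4 powi grid_level l"
  define n where "n = \<lfloor>(a + l) / q\<rfloor>"
  have q: "q > 0" "3 * l < q"
    using grid_level_bounds[OF assms(2)] by (auto simp: q_def)
  have bound: "a / q \<le> x / q" "x / q \<le> (a + l) / q" if "x \<in> I" for x
    using a(2) that q by (auto intro!: divide_right_mono)
  have "l / q < 1 / 3"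
    using q by (simp add: field_simps)
  then have short: "(a + l) / q - a / q < 1 / 3"
    by (simp add: add_divide_distrib)
  have n: "of_int n \<le> (a + l) / q" "(a + l) / q < of_int n + 1"
    unfolding n_def by linarith+
  show ?thesis
  proof (cases "of_int n \<le> a / q")
    case True
    have "grid_index False (grid_level l) x = n" if "x \<in> I" for x
      using bound[OF that] True n
      unfolding grid_index_def q_def[symmetric] floor_eq_iff by simp
    then show ?thesis
      unfolding grid_interval_def by blast
  next
    case False
    \<comment> \<open>in units of \<open>q\<close>, the endpoint \<open>n\<close> of the unshifted grid cuts the interval, so that \<open>n - 2/3\<close> and
    \<open>n + 1/3\<close>, the neighbouring endpoints of the shifted grid, lie outside\<close>
    have "grid_index True (grid_level l) x = n - 1" if "x \<in> I" for x
    proof -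
      have "of_int (n - 1) \<le> x / q - 1 / 3" "x / q - 1 / 3 < of_int (n - 1) + 1"
        using bound[OF that] False n short unfolding of_int_diff of_int_1 by linarith+
      then show ?thesis
        unfolding grid_index_def q_def[symmetric] floor_eq_iff by simp
    qed
    then show ?thesis
      unfolding grid_interval_def by blast
  qed
qed

section \<open>Volumes of boxes and of unions of grid cells\<close>

text \<open>Whatever the boundary of a box looks like, it lies between an open and a closed box that
  differ by a null set.\<close>

lemma emeasure_box_of_sides:
  assumes "box_of_sides x y z R" "x > 0" "y > 0" "z > 0"
  shows "R \<in> sets lebesgue" "emeasure lebesgue R = ennreal (x * y * z)"
proof -
  obtain I1 I2 I3 where I: "interval_of_length x I1" "interval_of_length y I2" "interval_of_length z I3"
    "R = {v. v $ 1 \<in> I1 \<and> v $ 2 \<in> I2 \<and> v $ 3 \<in> I3}"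
    using assms(1) unfolding box_of_sides_def by blast
  obtain a where a: "{a<..<a + x} \<subseteq> I1" "I1 \<subseteq> {a..a + x}"
    by (rule interval_of_length_between[OF I(1) assms(2)])
  obtain b where b: "{b<..<b + y} \<subseteq> I2" "I2 \<subseteq> {b..b + y}"
    by (rule interval_of_length_between[OF I(2) assms(3)])
  obtain c where c: "{c<..<c + z} \<subseteq> I3" "I3 \<subseteq> {c..c + z}"
    by (rule interval_of_length_between[OF I(3) assms(4)])
  define l :: "real ^ 3" where "l = vector [a, b, c]"
  define u :: "real ^ 3" where "u = vector [a + x, b + y, c + z]"
  have R: "box l u \<subseteq> R" "R \<subseteq> cbox l u"
    unfolding I(4) using a b c by (auto simp: l_def u_def mem_box_cart forall_3 subset_iff)
  have vol: "(\<Prod>b\<in>Basis. (u - l) \<bullet> b) = x * y * z"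
  proof -
    have basis: "(Basis :: (real ^ 3) set) = range (\<lambda>i. axis i 1)"
      by (auto simp: Basis_vec_def)
    have "inj (\<lambda>i::3. axis i (1::real) :: real ^ 3)"
      by (simp add: inj_def axis_eq_axis)
    from prod.reindex[OF this, of "\<lambda>b. (u - l) \<bullet> b"]
    have "(\<Prod>b\<in>Basis. (u - l) \<bullet> b) = (\<Prod>i\<in>UNIV. (u - l) \<bullet> axis i 1)"
      unfolding basis o_def .
    also have "\<dots> = (u - l) $ 1 * (u - l) $ 2 * (u - l) $ 3"
      unfolding UNIV_3 by (simp add: inner_axis)
    finally show ?thesis
      by (simp add: l_def u_def)
  qed
  have le: "l \<bullet> b \<le> u \<bullet> b" if "b \<in> Basis" for b
  proof -
    obtain i where "b = axis i 1"
      using \<open>b \<in> Basis\<close> by (auto simp: Basis_vec_def)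
    then show ?thesis
      using assms(2-4) exhaust_3[of i] by (auto simp: inner_axis l_def u_def)
  qed
  have "negligible (R - box l u)"
    by (rule negligible_subset[OF negligible_frontier_interval[of l u]]) (use R in auto)
  then have "box l u \<union> (R - box l u) \<in> sets lebesgue"
    by (intro sets.Un) (auto simp: negligible_iff_null_sets)
  then show R_sets: "R \<in> sets lebesgue"
    using R(1) by (simp add: Un_absorb1)
  have "emeasure lebesgue (box l u) \<le> emeasure lebesgue R"
    "emeasure lebesgue R \<le> emeasure lebesgue (cbox l u)"
    by (intro emeasure_mono R R_sets; simp)+
  then show "emeasure lebesgue R = ennreal (x * y * z)"
    using le vol by (simp add: emeasure_lborel_box emeasure_lborel_cbox)
qed

definition cell_index :: "bool \<times> bool \<times> bool \<Rightarrow> int \<Rightarrow> real ^ 3 \<Rightarrow> int \<times> int \<times> int" where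
  "cell_index = (\<lambda>(s1, s2, s3) k v. (grid_index s1 k (v $ 1), grid_index s2 k (v $ 2), grid_index s3 k (v $ 3)))"

definition grid_box ::
  "bool \<times> bool \<times> bool \<Rightarrow> int \<times> int \<times> int \<Rightarrow> int \<times> int \<times> int \<Rightarrow> (real ^ 3) set" where
  "grid_box = (\<lambda>(s1, s2, s3) (k1, k2, k3) (m1, m2, m3).
     {v. v $ 1 \<in> grid_interval s1 k1 m1 \<and> v $ 2 \<in> grid_interval s2 k2 m2 \<and> v $ 3 \<in> grid_interval s3 k3 m3})"

lemma emeasure_grid_box:
  "grid_box g (k1, k2, k3) m \<in> sets lebesgue"
  "emeasure lebesgue (grid_box g (k1, k2, k3) m) = ennreal (4 powi k1 * 4 powi k2 * 4 powi k3)"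
proof -
  have "box_of_sides (4 powi k1) (4 powi k2) (4 powi k3) (grid_box g (k1, k2, k3) m)"
    unfolding box_of_sides_def grid_box_def
    by (auto split: prod.splits intro!: exI interval_of_length_grid_interval)
  from emeasure_box_of_sides[OF this]
  show "grid_box g (k1, k2, k3) m \<in> sets lebesgue"
    "emeasure lebesgue (grid_box g (k1, k2, k3) m) = ennreal (4 powi k1 * 4 powi k2 * 4 powi k3)"
    by simp_all
qed

lemma cell_eq_grid_box: "{v. cell_index g k v = p} = grid_box g (k, k, k) p"
  by (auto simp: cell_index_def grid_box_def grid_interval_def split: prod.splits)

text \<open>Cells of level \<open>k\<close> turn volumes and integrals of the sets and functions that the grid resolves
  into cardinalities and finite sums.\<close>

lemma emeasure_cells:
  assumes "finite U"
  shows "{v. cell_index g k v \<in> U} \<in> sets lebesgue"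
    "emeasure lebesgue {v. cell_index g k v \<in> U} = ennreal ((4 powi k) ^ 3 * card U)"
proof -
  have eq: "{v. cell_index g k v \<in> U} = (\<Union>p\<in>U. grid_box g (k, k, k) p)"
    by (auto simp: cell_eq_grid_box[symmetric])
  show "{v. cell_index g k v \<in> U} \<in> sets lebesgue"
    unfolding eq using assms by (intro sets.finite_UN emeasure_grid_box)
  have "emeasure lebesgue (\<Union>p\<in>U. grid_box g (k, k, k) p) = (\<Sum>p\<in>U. emeasure lebesgue (grid_box g (k, k, k) p))"
  proof (rule sum_emeasure[symmetric])
    show "disjoint_family_on (grid_box g (k, k, k)) U"
      by (auto simp: disjoint_family_on_def cell_eq_grid_box[symmetric])
  qed (use assms in \<open>auto simp: emeasure_grid_box\<close>)
  also have "\<dots> = ennreal ((4 powi k) ^ 3 * card U)"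
    by (simp add: emeasure_grid_box ennreal_of_nat_eq_real_of_nat ennreal_mult' power3_eq_cube mult_ac)
  finally show "emeasure lebesgue {v. cell_index g k v \<in> U} = ennreal ((4 powi k) ^ 3 * card U)"
    unfolding eq .
qed

lemma nn_integral_cells:
  assumes "finite U" "\<And>p. p \<notin> U \<Longrightarrow> f p = 0" "\<And>p. 0 \<le> f p"
  shows "(\<lambda>v. ennreal (f (cell_index g k v))) \<in> borel_measurable lebesgue"
    "(\<integral>\<^sup>+v. ennreal (f (cell_index g k v)) \<partial>lebesgue) = ennreal ((4 powi k) ^ 3 * (\<Sum>p\<in>U. f p))"
proof -
  have cells: "ennreal (f (cell_index g k v)) = (\<Sum>p\<in>U. ennreal (f p) * indicator (grid_box g (k, k, k) p) v)" for v
  proof -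
    have "(\<Sum>p\<in>U. ennreal (f p) * indicator (grid_box g (k, k, k) p) v)
        = (\<Sum>p\<in>U. if p = cell_index g k v then ennreal (f p) else 0)"
      by (intro sum.cong) (auto simp: cell_eq_grid_box[symmetric])
    then show ?thesis
      using assms by (simp add: sum.delta)
  qed
  have "grid_box g (k, k, k) p \<in> sets lebesgue" for p
    by (rule emeasure_grid_box)
  then show "(\<lambda>v. ennreal (f (cell_index g k v))) \<in> borel_measurable lebesgue"
    unfolding cells by measurable
  from cells have "(\<integral>\<^sup>+v. ennreal (f (cell_index g k v)) \<partial>lebesgue)
      = (\<Sum>p\<in>U. \<integral>\<^sup>+v. ennreal (f p) * indicator (grid_box g (k, k, k) p) v \<partial>lebesgue)"
    using emeasure_grid_box(1) by (simp add: nn_integral_sum)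
  also have "\<dots> = (\<Sum>p\<in>U. ennreal (f p) * ennreal ((4 powi k) ^ 3))"
    by (intro sum.cong)
      (simp_all add: nn_integral_cmult_indicator emeasure_grid_box power3_eq_cube)
  also have "\<dots> = ennreal (\<Sum>p\<in>U. f p * (4 powi k) ^ 3)"
    using assms(3) by (simp add: ennreal_mult'[symmetric] sum_ennreal)
  finally show "(\<integral>\<^sup>+v. ennreal (f (cell_index g k v)) \<partial>lebesgue) = ennreal ((4 powi k) ^ 3 * (\<Sum>p\<in>U. f p))"
    by (simp add: sum_distrib_right[symmetric] mult.commute)
qed

lemma finite_grid_cells: "finite (grid_index s k ` grid_interval s l m)"
proof (rule finite_subset)
  show "grid_index s k ` grid_interval s l m \<subseteq>
      {grid_index s k (4 powi l * (m + of_bool s / 3))..grid_index s k (4 powi l * (m + of_bool s / 3) + 4 powi l)}"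
    unfolding grid_interval_eq grid_index_def
    by (auto intro!: floor_mono diff_right_mono divide_right_mono)
qed simp

text \<open>A cell of a finer level lies on one side of the boundary of a grid interval, so nothing is lost
  by replacing the interval by the indices of its cells.\<close>

lemma mem_grid_interval_iff_cell:
  assumes "k \<le> l"
  shows "x \<in> grid_interval s l m \<longleftrightarrow> grid_index s k x \<in> grid_index s k ` grid_interval s l m"
proof
  assume "grid_index s k x \<in> grid_index s k ` grid_interval s l m"
  then obtain y where "grid_index s k x = grid_index s k y" "y \<in> grid_interval s l m"
    by (elim imageE)
  then show "x \<in> grid_interval s l m"
    using grid_index_coarsen[OF assms, of s x y] by (simp add: grid_interval_def)
qed simp

lemma grid_cells_nested:
  assumes "k \<le> l" "l \<le> l'"
    and "grid_index s k ` grid_interval s l m \<inter> grid_index s k ` grid_interval s l' m' \<noteq> {}"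
  shows "grid_index s k ` grid_interval s l m \<subseteq> grid_index s k ` grid_interval s l' m'"
proof -
  obtain x where "x \<in> grid_interval s l m" "grid_index s k x \<in> grid_index s k ` grid_interval s l' m'"
    using assms(3) by blast
  then have "x \<in> grid_interval s l' m'"
    using mem_grid_interval_iff_cell[OF order_trans[OF assms(1,2)]] by blast
  with \<open>x \<in> grid_interval s l m\<close> have "grid_interval s l m \<subseteq> grid_interval s l' m'"
    by (intro grid_interval_subset[OF assms(2)]) auto
  then show ?thesis
    by (rule image_mono)
qed

lemma laminar_grid_cells:
  assumes "\<And>i. i \<in> T \<Longrightarrow> k \<le> l i"
  shows "laminar ((\<lambda>i. grid_index s k ` grid_interval s (l i) (m i)) ` T)"
  unfolding laminar_def
proof (intro ballI; elim imageE; hypsubst)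
  fix i j assume "i \<in> T" "j \<in> T"
  with assms show "grid_index s k ` grid_interval s (l i) (m i) \<inter> grid_index s k ` grid_interval s (l j) (m j) = {} \<or>
      grid_index s k ` grid_interval s (l i) (m i) \<subseteq> grid_index s k ` grid_interval s (l j) (m j) \<or>
      grid_index s k ` grid_interval s (l j) (m j) \<subseteq> grid_index s k ` grid_interval s (l i) (m i)"
    using grid_cells_nested[of k "l i" "l j" s "m i" "m j"] grid_cells_nested[of k "l j" "l i" s "m j" "m i"]
    by (metis Int_commute linear)
qed

section \<open>Finite families of rectangles\<close>

lemma square_le_exponential: "(real n)\<^sup>2 \<le> 2 * (2 ^ n - 1)"
proof (induction n)
  case (Suc n)
  have "Suc n \<le> 2 ^ n"
    by (rule Suc_leI) (rule less_exp)
  then have "real (Suc n) \<le> 2 ^ n"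
    by (metis of_nat_le_iff of_nat_numeral of_nat_power)
  with Suc show ?case
    by (simp add: power2_eq_square algebra_simps)
qed simp

text \<open>As \<open>n\<^sup>2 / 2 \<le> 2 ^ n - 1\<close>, this is the arithmetic-geometric mean inequality
  for \<open>L\<close> and \<open>n\<^sup>2 / (4 * L)\<close>. The coefficient \<open>1 / (2 * L)\<close> can be made small enough for
  the exponential term to be absorbed.\<close>

lemma linear_le_exponential:
  assumes "L > 0"
  shows "real n \<le> L + (2 ^ n - 1) / (2 * L)"
proof -
  have "0 \<le> (2 * L - real n)\<^sup>2"
    by simp
  then have "4 * L * n \<le> 4 * L * L + (real n)\<^sup>2"
    by (simp add: power2_eq_square algebra_simps)
  also have "\<dots> \<le> 4 * L * L + 2 * (2 ^ n - 1)"
    using square_le_exponential by simp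
  finally have "real n \<le> (4 * L * L + 2 * (2 ^ n - 1)) / (4 * L)"
    using assms by (simp add: pos_le_divide_eq mult.commute)
  also have "\<dots> = L + (2 ^ n - 1) / (2 * L)"
    using assms by (simp add: add_divide_distrib) (simp add: field_simps)
  finally show ?thesis .
qed

text \<open>Write \<open>V\<close> for the sum of the volumes of the selected rectangles and \<open>M\<close> for the volume of their union.
  A grid box has at most \<open>12 ^ 3 = 1728\<close> times the volume of its rectangle, so the greedy selection among the
  grid boxes covers at most \<open>9 * 1728 * V\<close> and has excess \<open>\<integral> (2 ^ N - 1)\<close> at most \<open>4 * 1728 * V\<close>.
  With \<open>L = 4 * 1728\<close> in \<open>linear_le_exponential\<close> the excess contributes at most \<open>V / 2\<close> to the bound for \<open>V\<close>,
  whence \<open>V \<le> 8 * 1728 * M\<close>. The constant is \<open>72 * 1728\<^sup>2 = (9 * 1728) * (8 * 1728)\<close>;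
  it also exceeds \<open>(4 * 1728) * (8 * 1728) + 1\<close>, which bounds the integral relative to \<open>M\<close>. The hypothesis \<open>mono\<close>
  is the monotonicity of \<open>\<phi>\<close> in terms of the sides.\<close>

theorem single_grid_selection:
  fixes R :: "'i \<Rightarrow> (real ^ 3) set" and X Y Z :: "'i \<Rightarrow> real" and m :: "'i \<Rightarrow> int \<times> int \<times> int"
    and g :: "bool \<times> bool \<times> bool"
  defines "D \<equiv> \<lambda>i. grid_box g (grid_level (X i), grid_level (Y i), grid_level (Z i)) (m i)"
  assumes "finite T"
    and pos: "\<And>i. i \<in> T \<Longrightarrow> X i > 0" "\<And>i. i \<in> T \<Longrightarrow> Y i > 0" "\<And>i. i \<in> T \<Longrightarrow> Z i > 0"
    and box: "\<And>i. i \<in> T \<Longrightarrow> box_of_sides (X i) (Y i) (Z i) (R i)"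
    and RD: "\<And>i. i \<in> T \<Longrightarrow> R i \<subseteq> D i"
    and mono: "\<And>i j. i \<in> T \<Longrightarrow> j \<in> T \<Longrightarrow> X i \<le> X j \<Longrightarrow> Y i \<le> Y j \<Longrightarrow> Z i \<le> Z j"
  shows "\<exists>S\<subseteq>T. emeasure lebesgue (\<Union>(D ` T)) \<le> ennreal (72 * 1728\<^sup>2) * emeasure lebesgue (\<Union>(R ` S)) \<and>
    (\<integral>\<^sup>+v\<in>\<Union>(R ` S). ennreal (2 ^ overlap R S v) \<partial>lebesgue)
      \<le> ennreal (72 * 1728\<^sup>2) * emeasure lebesgue (\<Union>(R ` S))"
proof -
  obtain s1 s2 s3 where g: "g = (s1, s2, s3)"
    by (cases g)
  \<comment> \<open>a level at which all the grid boxes are unions of cells; the \<open>0\<close> provides for empty \<open>T\<close>\<close>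
  define k where "k = Min (insert 0 ((grid_level \<circ> X) ` T \<union> (grid_level \<circ> Y) ` T \<union> (grid_level \<circ> Z) ` T))"
  have k: "k \<le> grid_level (X i)" "k \<le> grid_level (Y i)" "k \<le> grid_level (Z i)" if "i \<in> T" for i
    using that \<open>finite T\<close> by (auto simp: k_def intro!: Min_le)
  define w :: real where "w = (4 powi k) ^ 3"
  have "w > 0"
    by (simp add: w_def)
  define A where "A i = grid_index s1 k ` grid_interval s1 (grid_level (X i)) (fst (m i))" for i
  define B where "B i = grid_index s2 k ` grid_interval s2 (grid_level (Y i)) (fst (snd (m i)))" for i
  define C where "C i = grid_index s3 k ` grid_interval s3 (grid_level (Z i)) (snd (snd (m i)))" for i
  define E where "E = (\<lambda>i. A i \<times> B i \<times> C i)"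
  have D_iff: "v \<in> D i \<longleftrightarrow> cell_index g k v \<in> E i" if "i \<in> T" for i v
  proof -
    have "v \<in> D i \<longleftrightarrow> v $ 1 \<in> grid_interval s1 (grid_level (X i)) (fst (m i)) \<and>
        v $ 2 \<in> grid_interval s2 (grid_level (Y i)) (fst (snd (m i))) \<and>
        v $ 3 \<in> grid_interval s3 (grid_level (Z i)) (snd (snd (m i)))"
      by (simp add: D_def g grid_box_def split: prod.split)
    also have "\<dots> \<longleftrightarrow> grid_index s1 k (v $ 1) \<in> A i \<and> grid_index s2 k (v $ 2) \<in> B i \<and> grid_index s3 k (v $ 3) \<in> C i"
      unfolding A_def B_def C_def by (intro conj_cong mem_grid_interval_iff_cell k that)
    finally show ?thesis
      by (simp add: E_def g cell_index_def)
  qed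
  have finE: "finite (E i)" for i
    by (simp add: E_def A_def B_def C_def finite_grid_cells)

  have "\<exists>S\<subseteq>T. (\<Sum>p\<in>\<Union>(E ` T). 2 ^ overlap E S p - 1) \<le> 4 * (\<Sum>s\<in>S. real (card (E s))) \<and>
    real (card (\<Union>(E ` T))) \<le> 9 * (\<Sum>s\<in>S. real (card (E s)))"
    unfolding E_def
  proof (rule greedy_selection)
    show "laminar (A ` T)" "laminar (B ` T)"
      unfolding A_def B_def using k by (auto intro!: laminar_grid_cells)
  next
    fix T' assume T': "T' \<subseteq> T" "T' \<noteq> {}"
    then have "finite T'"
      using \<open>finite T\<close> finite_subset by blast
    \<comment> \<open>The last box has minimal third side. As \<open>Z\<close> need not grow strictly with \<open>X\<close> and \<open>Y\<close>, a box of the same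
    third side could still be shorter in both other directions, so the sum of these sides is minimised next.\<close>
    define T0 where "T0 = {i\<in>T'. Z i = Min (Z ` T')}"
    have "Min (Z ` T') \<in> Z ` T'"
      using \<open>finite T'\<close> T' by (intro Min_in) auto
    then have T0: "finite T0" "T0 \<noteq> {}"
      using \<open>finite T'\<close> by (auto simp: T0_def)
    have "Min ((\<lambda>i. X i + Y i) ` T0) \<in> (\<lambda>i. X i + Y i) ` T0"
      using T0 by (intro Min_in) auto
    then obtain j where j: "j \<in> T0" "X j + Y j = Min ((\<lambda>i. X i + Y i) ` T0)"
      by auto
    have jT: "j \<in> T'" "Z j = Min (Z ` T')"
      using j(1) by (auto simp: T0_def)
    have later: "Z j \<le> Z i \<and> (X j \<le> X i \<or> Y j \<le> Y i)" if "i \<in> T'" for i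
    proof -
      have Zj: "Z j \<le> Z i"
        unfolding jT(2) using \<open>finite T'\<close> that by simp
      moreover have "X j \<le> X i \<or> Y j \<le> Y i"
      proof (rule ccontr)
        assume "\<not> ?thesis"
        then have less: "X i < X j" "Y i < Y j" by auto
        then have "Z i \<le> Z j"
          using mono[of i j] T' that jT(1) by auto
        with Zj have "i \<in> T0"
          using that jT by (simp add: T0_def)
        then have "X j + Y j \<le> X i + Y i"
          unfolding j(2) using T0(1) by simp
        with less show False by simp
      qed
      ultimately show ?thesis by blast
    qed
    show "\<exists>j\<in>T'. \<forall>i\<in>T'. A i \<times> B i \<times> C i \<inter> A j \<times> B j \<times> C j \<noteq> {} \<longrightarrow> C j \<subseteq> C i \<and> (A j \<subseteq> A i \<or> B j \<subseteq> B i)"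
    proof (intro bexI[OF _ jT(1)] ballI impI)
      fix i assume i: "i \<in> T'" and meet: "A i \<times> B i \<times> C i \<inter> A j \<times> B j \<times> C j \<noteq> {}"
      have inT: "i \<in> T" "j \<in> T"
        using i jT(1) T'(1) by auto
      have meets: "A j \<inter> A i \<noteq> {}" "B j \<inter> B i \<noteq> {}" "C j \<inter> C i \<noteq> {}"
        using meet by auto
      have "C j \<subseteq> C i"
        using later[OF i] meets(3) inT k pos unfolding C_def
        by (intro grid_cells_nested grid_level_mono) auto
      moreover have "A j \<subseteq> A i" if "X j \<le> X i"
        using that meets(1) inT k pos unfolding A_def
        by (intro grid_cells_nested grid_level_mono) auto
      moreover have "B j \<subseteq> B i" if "Y j \<le> Y i"
        using that meets(2) inT k pos unfolding B_def
        by (intro grid_cells_nested grid_level_mono) auto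
      ultimately show "C j \<subseteq> C i \<and> (A j \<subseteq> A i \<or> B j \<subseteq> B i)"
        using later[OF i] by blast
    qed
  qed (auto simp: \<open>finite T\<close> A_def B_def C_def finite_grid_cells)
  then obtain S where "S \<subseteq> T" and
    excess: "(\<Sum>p\<in>\<Union>(E ` T). 2 ^ overlap E S p - 1) \<le> 4 * (\<Sum>s\<in>S. real (card (E s)))" and
    cover: "real (card (\<Union>(E ` T))) \<le> 9 * (\<Sum>s\<in>S. real (card (E s)))"
    by blast
  have finS: "finite S"
    using \<open>S \<subseteq> T\<close> \<open>finite T\<close> finite_subset by blast
  define V where "V = (\<Sum>i\<in>S. X i * Y i * Z i)"
  define \<Phi> where "\<Phi> = (\<Sum>p\<in>\<Union>(E ` T). (2::real) ^ overlap E S p - 1)"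
  define U where "U = \<Union>(R ` S)"

  have R_sets: "R i \<in> sets lebesgue" and R_vol: "emeasure lebesgue (R i) = ennreal (X i * Y i * Z i)"
    if "i \<in> T" for i
    using emeasure_box_of_sides[OF box pos] that by auto
  have card_le: "w * real (card (E i)) \<le> 1728 * (X i * Y i * Z i)" if "i \<in> T" for i
  proof -
    have "D i = {v. cell_index g k v \<in> E i}"
      using D_iff[OF that] by auto
    then have "ennreal (w * card (E i)) = emeasure lebesgue (D i)"
      using emeasure_cells(2)[OF finE, of g k i] by (simp add: w_def)
    also have "\<dots> = ennreal (4 powi grid_level (X i) * 4 powi grid_level (Y i) * 4 powi grid_level (Z i))"
      unfolding D_def by (rule emeasure_grid_box)
    finally have "ennreal (w * card (E i)) = ennreal (4 powi grid_level (X i) * 4 powi grid_level (Y i) * 4 powi grid_level (Z i))" .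
    then have "w * card (E i) = 4 powi grid_level (X i) * 4 powi grid_level (Y i) * 4 powi grid_level (Z i)"
      using \<open>w > 0\<close> by (subst (asm) ennreal_inj) auto
    also have "\<dots> \<le> (12 * X i) * (12 * Y i) * (12 * Z i)"
      using pos[OF that] grid_level_bounds(2) by (intro mult_mono) auto
    finally show ?thesis by simp
  qed
  have "w * (\<Sum>s\<in>S. real (card (E s))) \<le> 1728 * V"
    unfolding V_def sum_distrib_left using card_le \<open>S \<subseteq> T\<close> by (intro sum_mono) auto
  then have \<Phi>_le: "w * \<Phi> \<le> 4 * 1728 * V" and cover_le: "w * card (\<Union>(E ` T)) \<le> 9 * 1728 * V"
    using mult_left_mono[OF excess, of w] mult_left_mono[OF cover, of w] \<open>w > 0\<close>
    unfolding \<Phi>_def mult.left_commute[of w 4] mult.left_commute[of w 9] by linarith+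

  have overlap_D: "overlap D S v = overlap E S (cell_index g k v)" for v
    unfolding overlap_def using D_iff \<open>S \<subseteq> T\<close> by (metis (no_types, lifting) subsetD)
  have overlap_RD: "overlap R S v \<le> overlap D S v" for v
    unfolding overlap_def using finS RD \<open>S \<subseteq> T\<close> by (intro card_mono) auto
  have zero: "(2::real) ^ overlap E S p - 1 = 0" if "p \<notin> \<Union>(E ` T)" for p
  proof -
    have "{s\<in>S. p \<in> E s} = {}"
      using that \<open>S \<subseteq> T\<close> by auto
    then show ?thesis
      unfolding overlap_def by (simp only: card.empty) simp
  qed
  have "finite (\<Union>(E ` T))"
    using \<open>finite T\<close> finE by blast
  note cells = nn_integral_cells[of "\<Union>(E ` T)" "\<lambda>p. 2 ^ overlap E S p - 1" g k, OF this zero]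
  have D_meas: "(\<lambda>v. ennreal (2 ^ overlap D S v - 1)) \<in> borel_measurable lebesgue"
    unfolding overlap_D by (rule cells(1)) auto
  have D_integral: "(\<integral>\<^sup>+v. ennreal (2 ^ overlap D S v - 1) \<partial>lebesgue) = ennreal (w * \<Phi>)"
    unfolding overlap_D w_def \<Phi>_def by (rule cells(2)) auto
  have U_sets: "U \<in> sets lebesgue"
    unfolding U_def using R_sets \<open>S \<subseteq> T\<close> finS by (intro sets.finite_UN) auto
  have V_sum: "ennreal V = (\<Sum>i\<in>S. emeasure lebesgue (R i))"
    unfolding V_def using R_vol \<open>S \<subseteq> T\<close> pos
    by (subst sum_ennreal[symmetric]) (auto simp: subset_iff less_imp_le)
  have U_le: "emeasure lebesgue U \<le> ennreal V"
    unfolding U_def V_sum using R_sets \<open>S \<subseteq> T\<close> finS by (intro emeasure_subadditive_finite) auto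
  define M where "M = measure lebesgue U"
  have U_M: "emeasure lebesgue U = ennreal M"
    unfolding M_def using U_le by (intro emeasure_eq_ennreal_measure) (auto simp: top_unique)
  have "M \<ge> 0"
    by (simp add: M_def)
  have "w * \<Phi> \<ge> 0"
    using \<open>w > 0\<close> by (auto simp: \<Phi>_def intro!: mult_nonneg_nonneg sum_nonneg)

  have "ennreal V = (\<Sum>i\<in>S. \<integral>\<^sup>+v. indicator (R i) v \<partial>lebesgue)"
    unfolding V_sum using R_sets \<open>S \<subseteq> T\<close> by (intro sum.cong) (auto simp: nn_integral_indicator)
  also have "\<dots> = (\<integral>\<^sup>+v. (\<Sum>i\<in>S. indicator (R i) v) \<partial>lebesgue)"
    using R_sets \<open>S \<subseteq> T\<close> by (intro nn_integral_sum[symmetric]) auto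
  also have "\<dots> \<le> (\<integral>\<^sup>+v. ennreal (4 * 1728) * indicator U v
      + ennreal (1 / (2 * (4 * 1728))) * ennreal (2 ^ overlap D S v - 1) \<partial>lebesgue)"
  proof (rule nn_integral_mono)
    fix v
    have "(\<Sum>i\<in>S. indicator (R i) v :: ennreal) = ennreal (real (overlap R S v))"
      unfolding overlap_def using finS by (simp add: indicator_def sum.If_cases Int_def ennreal_of_nat_eq_real_of_nat)
    also have "\<dots> \<le> ennreal (4 * 1728) * indicator U v
        + ennreal (1 / (2 * (4 * 1728))) * ennreal (2 ^ overlap D S v - 1)"
    proof (cases "v \<in> U")
      case True
      have "real (overlap R S v) \<le> real (overlap D S v)"
        using overlap_RD by simp
      also have "\<dots> \<le> 4 * 1728 + (2 ^ overlap D S v - 1) / (2 * (4 * 1728))"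
        by (rule linear_le_exponential) simp
      also have "\<dots> = 4 * 1728 + 1 / (2 * (4 * 1728)) * (2 ^ overlap D S v - 1)"
        by simp
      finally have "ennreal (real (overlap R S v)) \<le> ennreal (4 * 1728 + 1 / (2 * (4 * 1728)) * (2 ^ overlap D S v - 1))"
        by (rule ennreal_leI)
      also have "\<dots> = ennreal (4 * 1728) + ennreal (1 / (2 * (4 * 1728)) * (2 ^ overlap D S v - 1))"
        by (rule ennreal_plus) auto
      also have "\<dots> = ennreal (4 * 1728) + ennreal (1 / (2 * (4 * 1728))) * ennreal (2 ^ overlap D S v - 1)"
        by (subst ennreal_mult) auto
      finally show ?thesis
        using True by simp
    next
      case False
      then have "{s\<in>S. v \<in> R s} = {}"
        by (auto simp: U_def)
      then show ?thesis
        unfolding overlap_def by (simp only: card.empty) simp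
    qed
    finally show "(\<Sum>i\<in>S. indicator (R i) v) \<le> ennreal (4 * 1728) * indicator U v
        + ennreal (1 / (2 * (4 * 1728))) * ennreal (2 ^ overlap D S v - 1)" .
  qed
  also have "\<dots> = ennreal (4 * 1728) * ennreal M + ennreal (1 / (2 * (4 * 1728))) * ennreal (w * \<Phi>)"
    using U_sets D_meas by (simp add: nn_integral_add nn_integral_cmult nn_integral_cmult_indicator U_M D_integral)
  also have "\<dots> = ennreal (4 * 1728 * M + w * \<Phi> / (2 * (4 * 1728)))"
  proof -
    have "ennreal (4 * 1728) * ennreal M = ennreal (4 * 1728 * M)"
      using \<open>M \<ge> 0\<close> by (intro ennreal_mult[symmetric]) auto
    moreover have "ennreal (1 / (2 * (4 * 1728))) * ennreal (w * \<Phi>) = ennreal (1 / (2 * (4 * 1728)) * (w * \<Phi>))"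
      using \<open>w * \<Phi> \<ge> 0\<close> by (intro ennreal_mult[symmetric]) auto
    moreover have "ennreal (4 * 1728 * M) + ennreal (1 / (2 * (4 * 1728)) * (w * \<Phi>)) =
        ennreal (4 * 1728 * M + 1 / (2 * (4 * 1728)) * (w * \<Phi>))"
      using \<open>M \<ge> 0\<close> \<open>w * \<Phi> \<ge> 0\<close> by (intro ennreal_plus[symmetric]) auto
    ultimately show ?thesis by simp
  qed
  finally have "V \<le> 4 * 1728 * M + w * \<Phi> / (2 * (4 * 1728))"
    using \<open>M \<ge> 0\<close> \<open>w * \<Phi> \<ge> 0\<close> by (subst (asm) ennreal_le_iff) auto
  with \<Phi>_le have V_le: "V \<le> 8 * 1728 * M"
    by simp

  have "emeasure lebesgue (\<Union>(D ` T)) = ennreal (w * card (\<Union>(E ` T)))"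
  proof -
    have "\<Union>(D ` T) = {v. cell_index g k v \<in> \<Union>(E ` T)}"
      using D_iff by auto
    then show ?thesis
      using \<open>finite T\<close> finE by (simp only: w_def) (intro emeasure_cells, auto)
  qed
  also have "\<dots> \<le> ennreal (72 * 1728\<^sup>2 * M)"
    using cover_le V_le by (intro ennreal_leI) simp
  also have "\<dots> = ennreal (72 * 1728\<^sup>2) * emeasure lebesgue U"
    using \<open>M \<ge> 0\<close> by (simp add: U_M ennreal_mult)
  finally have covered: "emeasure lebesgue (\<Union>(D ` T)) \<le> ennreal (72 * 1728\<^sup>2) * emeasure lebesgue U" .

  have "(\<integral>\<^sup>+v\<in>U. ennreal (2 ^ overlap R S v) \<partial>lebesgue)
      \<le> (\<integral>\<^sup>+v. ennreal (2 ^ overlap D S v - 1) + indicator U v \<partial>lebesgue)"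
  proof (rule nn_integral_mono)
    fix v
    have "(2::real) ^ overlap R S v \<le> 2 ^ overlap D S v"
      using overlap_RD by (intro power_increasing) auto
    then have "ennreal (2 ^ overlap R S v) \<le> ennreal ((2 ^ overlap D S v - 1) + 1)"
      by (intro ennreal_leI) simp
    also have "\<dots> = ennreal (2 ^ overlap D S v - 1) + 1"
      by (subst ennreal_plus) auto
    finally show "ennreal (2 ^ overlap R S v) * indicator U v \<le> ennreal (2 ^ overlap D S v - 1) + indicator U v"
      by (simp split: split_indicator)
  qed
  also have "\<dots> = ennreal (w * \<Phi>) + ennreal M"
    using U_sets D_meas by (simp add: nn_integral_add U_M D_integral)
  also have "\<dots> = ennreal (w * \<Phi> + M)"
    using \<open>M \<ge> 0\<close> \<open>w * \<Phi> \<ge> 0\<close> by simp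
  also have "\<dots> \<le> ennreal (72 * 1728\<^sup>2 * M)"
    using \<Phi>_le V_le \<open>M \<ge> 0\<close> by (intro ennreal_leI) simp
  also have "\<dots> = ennreal (72 * 1728\<^sup>2) * emeasure lebesgue U"
    using \<open>M \<ge> 0\<close> by (simp add: U_M ennreal_mult)
  finally show ?thesis
    using \<open>S \<subseteq> T\<close> covered unfolding U_def by (intro exI[of _ S] conjI)
qed

text \<open>Each rectangle comes with its own choice of grids; the class that covers the largest volume has at
  least an eighth of the total.\<close>

theorem finite_family_selection:
  fixes R :: "'i \<Rightarrow> (real ^ 3) set" and X Y Z :: "'i \<Rightarrow> real" and m :: "'i \<Rightarrow> int \<times> int \<times> int"
    and g :: "'i \<Rightarrow> bool \<times> bool \<times> bool"
  defines "D \<equiv> \<lambda>i. grid_box (g i) (grid_level (X i), grid_level (Y i), grid_level (Z i)) (m i)"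
  assumes "finite T"
    and pos: "\<And>i. i \<in> T \<Longrightarrow> X i > 0" "\<And>i. i \<in> T \<Longrightarrow> Y i > 0" "\<And>i. i \<in> T \<Longrightarrow> Z i > 0"
    and box: "\<And>i. i \<in> T \<Longrightarrow> box_of_sides (X i) (Y i) (Z i) (R i)"
    and RD: "\<And>i. i \<in> T \<Longrightarrow> R i \<subseteq> D i"
    and mono: "\<And>i j. i \<in> T \<Longrightarrow> j \<in> T \<Longrightarrow> X i \<le> X j \<Longrightarrow> Y i \<le> Y j \<Longrightarrow> Z i \<le> Z j"
  shows "\<exists>S\<subseteq>T. emeasure lebesgue (\<Union>(D ` T)) \<le> ennreal (8 * (72 * 1728\<^sup>2)) * emeasure lebesgue (\<Union>(R ` S)) \<and>
    (\<integral>\<^sup>+v\<in>\<Union>(R ` S). ennreal (2 ^ overlap R S v) \<partial>lebesgue)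
      \<le> ennreal (72 * 1728\<^sup>2) * emeasure lebesgue (\<Union>(R ` S))"
proof -
  define part where "part h = {i\<in>T. g i = h}" for h
  define \<mu> where "\<mu> h = emeasure lebesgue (\<Union>(D ` part h))" for h
  have "Max (range \<mu>) \<in> range \<mu>"
    by (intro Max_in) auto
  then obtain h where h: "\<mu> h = Max (range \<mu>)"
    by (metis rangeE)
  have max: "\<mu> h' \<le> \<mu> h" for h'
    unfolding h by (intro Max_ge) auto
  have D_sets: "D i \<in> sets lebesgue" for i
    unfolding D_def by (rule emeasure_grid_box)
  have "emeasure lebesgue (\<Union>(D ` T)) = emeasure lebesgue (\<Union>h\<in>UNIV. \<Union>(D ` part h))"
    by (rule arg_cong[of _ _ "emeasure lebesgue"]) (auto simp: part_def)
  also have "\<dots> \<le> (\<Sum>h\<in>UNIV. \<mu> h)"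
    unfolding \<mu>_def using \<open>finite T\<close> D_sets
    by (intro emeasure_subadditive_finite) (auto simp: part_def intro!: sets.finite_UN)
  also have "\<dots> \<le> (\<Sum>h'\<in>(UNIV :: (bool \<times> bool \<times> bool) set). \<mu> h)"
    by (intro sum_mono max)
  also have "\<dots> = ennreal 8 * \<mu> h"
    by (simp add: card_UNIV_bool UNIV_Times_UNIV[symmetric] card_cartesian_product del: UNIV_Times_UNIV)
  finally have cover: "emeasure lebesgue (\<Union>(D ` T)) \<le> ennreal 8 * \<mu> h" .
  have D_h: "D i = grid_box h (grid_level (X i), grid_level (Y i), grid_level (Z i)) (m i)" if "i \<in> part h" for i
    using that by (simp add: D_def part_def)
  have "\<exists>S\<subseteq>part h. emeasure lebesgue (\<Union>i\<in>part h. grid_box h (grid_level (X i), grid_level (Y i), grid_level (Z i)) (m i))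
      \<le> ennreal (72 * 1728\<^sup>2) * emeasure lebesgue (\<Union>(R ` S)) \<and>
    (\<integral>\<^sup>+v\<in>\<Union>(R ` S). ennreal (2 ^ overlap R S v) \<partial>lebesgue)
      \<le> ennreal (72 * 1728\<^sup>2) * emeasure lebesgue (\<Union>(R ` S))"
  proof (rule single_grid_selection)
    show "R i \<subseteq> grid_box h (grid_level (X i), grid_level (Y i), grid_level (Z i)) (m i)" if "i \<in> part h" for i
      using RD[of i] D_h[OF that] that by (simp add: part_def)
  qed (use \<open>finite T\<close> pos box mono in \<open>auto simp: part_def\<close>)
  then obtain S where S: "S \<subseteq> part h" "\<mu> h \<le> ennreal (72 * 1728\<^sup>2) * emeasure lebesgue (\<Union>(R ` S))"
    "(\<integral>\<^sup>+v\<in>\<Union>(R ` S). ennreal (2 ^ overlap R S v) \<partial>lebesgue)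
      \<le> ennreal (72 * 1728\<^sup>2) * emeasure lebesgue (\<Union>(R ` S))"
    unfolding \<mu>_def using D_h by (metis (no_types, lifting) SUP_cong)
  have "S \<subseteq> T"
    using S(1) by (auto simp: part_def)
  have "emeasure lebesgue (\<Union>(D ` T)) \<le> ennreal 8 * (ennreal (72 * 1728\<^sup>2) * emeasure lebesgue (\<Union>(R ` S)))"
    using cover mult_left_mono[OF S(2), of "ennreal 8"] by (rule order_trans) simp
  also have "\<dots> = ennreal (8 * (72 * 1728\<^sup>2)) * emeasure lebesgue (\<Union>(R ` S))"
    by (subst ennreal_mult) (simp_all only: mult.assoc, simp_all)
  finally show ?thesis
    using \<open>S \<subseteq> T\<close> S(3) by (intro exI[of _ S] conjI)
qed

section \<open>Arbitrary families of rectangles\<close>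

lemma finite_subfamily_emeasure:
  assumes "countable I" "\<And>i. i \<in> I \<Longrightarrow> F i \<in> sets M" "a < emeasure M (\<Union>(F ` I))"
  shows "\<exists>J\<subseteq>I. finite J \<and> a < emeasure M (\<Union>(F ` J))"
proof -
  have "I \<noteq> {}"
    using assms(3) by auto
  define e where "e = from_nat_into I"
  have range: "range e = I"
    unfolding e_def using assms(1) \<open>I \<noteq> {}\<close> by (simp add: range_from_nat_into)
  define U where "U n = (\<Union>k\<le>n. F (e k))" for n
  have "range U \<subseteq> sets M"
    using assms(2) range by (auto simp: U_def intro!: sets.finite_UN)
  moreover have "incseq U"
    by (auto simp: U_def incseq_def intro: order_trans)
  moreover have "(\<Union>n. U n) = \<Union>(F ` I)"
    unfolding range[symmetric] by (auto simp: U_def)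
  ultimately have "(SUP n. emeasure M (U n)) = emeasure M (\<Union>(F ` I))"
    by (simp add: SUP_emeasure_incseq)
  with assms(3) obtain n where "a < emeasure M (U n)"
    by (metis less_SUP_iff)
  moreover have "U n = \<Union>(F ` e ` {..n})"
    by (auto simp: U_def)
  ultimately show ?thesis
    using range by (intro exI[of _ "e ` {..n}"]) auto
qed

lemma box_of_sides_in_grid_box:
  assumes "box_of_sides x y z R" "x > 0" "y > 0" "z > 0"
  shows "\<exists>g m. R \<subseteq> grid_box g (grid_level x, grid_level y, grid_level z) m"
proof -
  obtain I1 I2 I3 where I: "interval_of_length x I1" "interval_of_length y I2" "interval_of_length z I3"
    "R = {v. v $ 1 \<in> I1 \<and> v $ 2 \<in> I2 \<and> v $ 3 \<in> I3}"
    using assms(1) unfolding box_of_sides_def by blast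
  obtain s1 m1 s2 m2 s3 m3 where "I1 \<subseteq> grid_interval s1 (grid_level x) m1"
    "I2 \<subseteq> grid_interval s2 (grid_level y) m2" "I3 \<subseteq> grid_interval s3 (grid_level z) m3"
    using interval_in_grid[OF I(1) assms(2)] interval_in_grid[OF I(2) assms(3)]
      interval_in_grid[OF I(3) assms(4)] by (elim exE)
  then have "R \<subseteq> grid_box (s1, s2, s3) (grid_level x, grid_level y, grid_level z) (m1, m2, m3)"
    unfolding I(4) grid_box_def by auto
  then show ?thesis by blast
qed

lemma infsum_indicator_finite:
  assumes "finite S"
  shows "(\<Sum>\<^sub>\<infinity>R\<in>S. indicator R v :: ennreal) = of_nat (overlap (\<lambda>R. R) S v)"
  using assms by (simp add: overlap_def indicator_def sum.If_cases Int_def)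

lemma exp_ennreal_ln_2: "exp_ennreal (ennreal (ln 2) * of_nat n) = ennreal (2 ^ n)"
proof -
  have *: "ennreal (ln 2) * of_nat n = ennreal (ln 2 * n)"
    by (simp add: ennreal_of_nat_eq_real_of_nat ennreal_mult)
  have "exp (ln 2 * real n) = 2 ^ n"
    by (metis exp_ln exp_of_nat2_mult zero_less_numeral)
  then show ?thesis
    unfolding * exp_ennreal_def by simp
qed

theorem theorem2p1:
  shows "\<exists>C c :: real. C > 0 \<and> c > 0 \<and>
    (\<forall>\<phi> :: real \<Rightarrow> real \<Rightarrow> real. admissible \<phi> \<longrightarrow>
      (\<forall>\<R> \<subseteq> rectangles \<phi>. \<exists>\<S> \<subseteq> \<R>. countable \<S> \<and>
        emeasure lebesgue (\<Union>\<R>) \<le> ennreal C * emeasure lebesgue (\<Union>\<S>) \<and>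
        (\<integral>\<^sup>+ v \<in> \<Union>\<S>. exp_ennreal (ennreal c * (\<Sum>\<^sub>\<infinity>R\<in>\<S>. indicator R v)) \<partial>lebesgue)
          \<le> ennreal C * emeasure lebesgue (\<Union>\<S>)))"
proof -
  define K :: real where "K = 72 * 1728\<^sup>2"
  have "K > 0"
    by (simp add: K_def)
  have "\<exists>\<S> \<subseteq> \<R>. countable \<S> \<and>
        emeasure lebesgue (\<Union>\<R>) \<le> ennreal (16 * K) * emeasure lebesgue (\<Union>\<S>) \<and>
        (\<integral>\<^sup>+ v \<in> \<Union>\<S>. exp_ennreal (ennreal (ln 2) * (\<Sum>\<^sub>\<infinity>R\<in>\<S>. indicator R v)) \<partial>lebesgue)
          \<le> ennreal (16 * K) * emeasure lebesgue (\<Union>\<S>)"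
    if "admissible \<phi>" "\<R> \<subseteq> rectangles \<phi>" for \<phi> \<R>
  proof -
    have "\<forall>R\<in>\<R>. \<exists>x y. x > 0 \<and> y > 0 \<and> box_of_sides x y (\<phi> x y) R"
      using that(2) unfolding rectangles_def by blast
    then obtain X Y where XY: "X R > 0" "Y R > 0" "box_of_sides (X R) (Y R) (\<phi> (X R) (Y R)) R" if "R \<in> \<R>" for R
      by metis
    define Z where "Z R = \<phi> (X R) (Y R)" for R
    have Z: "Z R > 0" if "R \<in> \<R>" for R
      using \<open>admissible \<phi>\<close> XY[OF that] by (simp add: admissible_def Z_def)
    have mono: "Z R \<le> Z R'" if "R \<in> \<R>" "R' \<in> \<R>" "X R \<le> X R'" "Y R \<le> Y R'" for R R'
    proof -
      have "\<phi> (X R) (Y R) \<le> \<phi> (X R') (Y R)" "\<phi> (X R') (Y R) \<le> \<phi> (X R') (Y R')"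
        using \<open>admissible \<phi>\<close> XY[OF that(1)] XY[OF that(2)] that(3,4)
          mono_onD[of "{0<..}" "\<lambda>x. \<phi> x (Y R)" "X R" "X R'"]
          mono_onD[of "{0<..}" "\<phi> (X R')" "Y R" "Y R'"]
        by (auto simp: admissible_def)
      then show ?thesis by (simp add: Z_def)
    qed
    have "\<forall>R\<in>\<R>. \<exists>g m. R \<subseteq> grid_box g (grid_level (X R), grid_level (Y R), grid_level (Z R)) m"
      using box_of_sides_in_grid_box XY Z by (simp add: Z_def)
    then obtain g m where gm: "R \<subseteq> grid_box (g R) (grid_level (X R), grid_level (Y R), grid_level (Z R)) (m R)"
      if "R \<in> \<R>" for R
      by metis
    \<comment> \<open>a rectangle enters the covering only through its grid box, and these have countably many codes\<close>
    define code where "code R = (g R, (grid_level (X R), grid_level (Y R), grid_level (Z R)), m R)" for R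
    define D where "D R = grid_box (g R) (grid_level (X R), grid_level (Y R), grid_level (Z R)) (m R)" for R
    have D_code: "D R = D R'" if "code R = code R'" for R R'
      using that by (simp add: D_def code_def)
    have D_sets: "D R \<in> sets lebesgue" for R
      unfolding D_def by (rule emeasure_grid_box)
    define \<Q> where "\<Q> = inv_into \<R> code ` (code ` \<R>)"
    have "countable \<Q>"
      unfolding \<Q>_def by (rule countable_image, rule countableI_type)
    have "\<Q> \<subseteq> \<R>"
      unfolding \<Q>_def by (auto intro: inv_into_into)
    have "\<Union>\<R> \<subseteq> \<Union>(D ` \<Q>)"
    proof
      fix v assume "v \<in> \<Union>\<R>"
      then obtain R where "R \<in> \<R>" "v \<in> R" by blast
      then have "v \<in> D R" "inv_into \<R> code (code R) \<in> \<Q>"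
        using gm by (auto simp: D_def \<Q>_def)
      moreover have "D (inv_into \<R> code (code R)) = D R"
        using \<open>R \<in> \<R>\<close> by (intro D_code f_inv_into_f imageI)
      ultimately show "v \<in> \<Union>(D ` \<Q>)" by blast
    qed
    \<comment> \<open>unlike the arbitrary union on the left, the countable one on the right is visibly measurable\<close>
    then have le_D: "emeasure lebesgue (\<Union>\<R>) \<le> emeasure lebesgue (\<Union>(D ` \<Q>))"
      using \<open>countable \<Q>\<close> D_sets by (intro emeasure_mono sets.countable_UN') auto
    have select: "\<exists>S\<subseteq>T. emeasure lebesgue (\<Union>(D ` T)) \<le> ennreal (8 * K) * emeasure lebesgue (\<Union>S) \<and>
        (\<integral>\<^sup>+v\<in>\<Union>S. ennreal (2 ^ overlap (\<lambda>R. R) S v) \<partial>lebesgue) \<le> ennreal K * emeasure lebesgue (\<Union>S)"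
      if "finite T" "T \<subseteq> \<Q>" for T
    proof -
      have "T \<subseteq> \<R>"
        using that(2) \<open>\<Q> \<subseteq> \<R>\<close> by blast
      then show ?thesis
        using finite_family_selection[of T X Y Z "\<lambda>R. R" g m] that(1) XY Z gm mono
        by (simp add: K_def D_def Z_def subset_iff)
    qed
    show ?thesis
    proof (cases "emeasure lebesgue (\<Union>(D ` \<Q>)) = \<infinity>")
      case True
      \<comment> \<open>a countable subfamily whose union has infinite volume satisfies both estimates, and \<open>\<Q>\<close> is one\<close>
      have "\<Union>\<Q> \<in> sets lebesgue"
        using emeasure_box_of_sides(1)[OF XY(3,1,2)] Z \<open>\<Q> \<subseteq> \<R>\<close> \<open>countable \<Q>\<close>
        by (intro sets.countable_Union) (auto simp: Z_def)
      have "of_nat n \<le> ennreal (8 * K) * emeasure lebesgue (\<Union>\<Q>)" for n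
      proof -
        have "of_nat n < emeasure lebesgue (\<Union>(D ` \<Q>))"
          unfolding True by (simp add: ennreal_of_nat_eq_real_of_nat)
        then obtain T where T: "T \<subseteq> \<Q>" "finite T" "of_nat n < emeasure lebesgue (\<Union>(D ` T))"
          using finite_subfamily_emeasure[OF \<open>countable \<Q>\<close>, of D, OF D_sets] by blast
        obtain S where S: "S \<subseteq> T" "emeasure lebesgue (\<Union>(D ` T)) \<le> ennreal (8 * K) * emeasure lebesgue (\<Union>S)"
          using select[OF T(2,1)] by blast
        have "emeasure lebesgue (\<Union>S) \<le> emeasure lebesgue (\<Union>\<Q>)"
          using S(1) T(1) \<open>\<Union>\<Q> \<in> sets lebesgue\<close> by (intro emeasure_mono) auto
        with T(3) S(2) show ?thesis
          by (meson less_imp_le mult_left_mono order_trans zero_le)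
      qed
      then have "ennreal (8 * K) * emeasure lebesgue (\<Union>\<Q>) = \<infinity>"
        by (metis ennreal_Ex_less_of_nat infinity_ennreal_def leD top.not_eq_extremum)
      then have "emeasure lebesgue (\<Union>\<Q>) = \<infinity>"
        by (simp add: ennreal_mult_eq_top_iff)
      then have "ennreal (16 * K) * emeasure lebesgue (\<Union>\<Q>) = \<infinity>"
        using \<open>K > 0\<close> by (simp add: ennreal_mult_top)
      then show ?thesis
        using \<open>\<Q> \<subseteq> \<R>\<close> \<open>countable \<Q>\<close> by (intro exI[of _ \<Q>]) auto
    next
      case fin: False
      obtain T where T: "finite T" "T \<subseteq> \<Q>" "emeasure lebesgue (\<Union>(D ` \<Q>)) \<le> 2 * emeasure lebesgue (\<Union>(D ` T))"
      proof (cases "emeasure lebesgue (\<Union>(D ` \<Q>)) = 0")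
        case True
        then show ?thesis by (intro that[of "{}"]) auto
      next
        case False
        define \<mu> where "\<mu> = measure lebesgue (\<Union>(D ` \<Q>))"
        have \<mu>: "emeasure lebesgue (\<Union>(D ` \<Q>)) = ennreal \<mu>"
          unfolding \<mu>_def using fin by (intro emeasure_eq_ennreal_measure) simp
        with False have "\<mu> > 0"
          by (metis ennreal_eq_0_iff not_le)
        then have "ennreal (\<mu> / 2) < emeasure lebesgue (\<Union>(D ` \<Q>))"
          unfolding \<mu> by (intro ennreal_lessI) auto
        then obtain T where T: "T \<subseteq> \<Q>" "finite T" "ennreal (\<mu> / 2) < emeasure lebesgue (\<Union>(D ` T))"
          using finite_subfamily_emeasure[OF \<open>countable \<Q>\<close>, of D, OF D_sets] by blast
        have "emeasure lebesgue (\<Union>(D ` \<Q>)) = ennreal 2 * ennreal (\<mu> / 2)"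
          unfolding \<mu> using \<open>\<mu> > 0\<close> by (subst ennreal_mult[symmetric]) auto
        also have "\<dots> \<le> ennreal 2 * emeasure lebesgue (\<Union>(D ` T))"
          using T(3) by (intro mult_left_mono) auto
        finally have "emeasure lebesgue (\<Union>(D ` \<Q>)) \<le> 2 * emeasure lebesgue (\<Union>(D ` T))"
          by simp
        with T show ?thesis by (intro that)
      qed
      obtain S where S: "S \<subseteq> T" "emeasure lebesgue (\<Union>(D ` T)) \<le> ennreal (8 * K) * emeasure lebesgue (\<Union>S)"
          "(\<integral>\<^sup>+v\<in>\<Union>S. ennreal (2 ^ overlap (\<lambda>R. R) S v) \<partial>lebesgue) \<le> ennreal K * emeasure lebesgue (\<Union>S)"
        using select[OF T(1,2)] by blast
      have "finite S"
        using S(1) T(1) finite_subset by blast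
      have "emeasure lebesgue (\<Union>\<R>) \<le> 2 * (ennreal (8 * K) * emeasure lebesgue (\<Union>S))"
        using le_D T(3) mult_left_mono[OF S(2), of 2] by (meson order_trans zero_le)
      also have "\<dots> = ennreal (16 * K) * emeasure lebesgue (\<Union>S)"
      proof -
        have "ennreal 2 * ennreal (8 * K) = ennreal (2 * (8 * K))"
          using \<open>K > 0\<close> by (intro ennreal_mult[symmetric]) auto
        then show ?thesis
          by (simp add: mult.assoc[symmetric])
      qed
      finally have cover: "emeasure lebesgue (\<Union>\<R>) \<le> ennreal (16 * K) * emeasure lebesgue (\<Union>S)" .
      have "(\<integral>\<^sup>+ v \<in> \<Union>S. exp_ennreal (ennreal (ln 2) * (\<Sum>\<^sub>\<infinity>R\<in>S. indicator R v)) \<partial>lebesgue)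
          \<le> ennreal K * emeasure lebesgue (\<Union>S)"
        using S(3) by (simp only: infsum_indicator_finite[OF \<open>finite S\<close>] exp_ennreal_ln_2)
      also have "\<dots> \<le> ennreal (16 * K) * emeasure lebesgue (\<Union>S)"
        using \<open>K > 0\<close> by (intro mult_right_mono ennreal_leI) auto
      finally show ?thesis
        using cover S(1) T(2) \<open>\<Q> \<subseteq> \<R>\<close> \<open>finite S\<close>
        by (intro exI[of _ S] conjI) (auto intro: countable_finite)
    qed
  qed
  with \<open>K > 0\<close> show ?thesis
    by (intro exI[of _ "16 * K"] exI[of _ "ln 2"]) simp
qed

end
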